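(* Let $G=(V_G,E_G)$ be a graph, where $V_G$ is the set of vertices and $E_G$ the set of edges, regarded as a metric space with the path metric. Suppose there exists $\varepsilon>0$ such that for every $r$ there is a finite non-empty subgraph $G_r\subseteq G$ with the following property: for every set $A$ of vertices of $G_r$ whose diameter in $G$ is at most $r$, one has $|\partial_{G_r}(A)|\ge\varepsilon|A|$. Then the dimension growth of $G$ is exponential.
   Context: The distance between vertices of $G$ is the length of a shortest edge path. For a set $A$ of vertices of $G_r$, $\partial_{G_r}(A)=\{v\in G_r\mid \mathrm{dist}(v,A)=1\}$ is the boundary of $A$ in $G_r$, i.e. the set of vertices of $G_r$ not in $A$ that are adjacent in $G_r$ to a vertex of $A$. Let $X$ be a metric space (for the graph $G$, take $X=V_G$) and $\lambda>0$. A $\lambda$-path from $x$ to $y$ is a finite sequence of points $x=z_0,z_1,\dots,z_n=y$ in which the distance between any two consecutive points is at most $\lambda$. A set of points is a $\lambda$-cluster if every two of its points are joined by a $\lambda$-path in the set. For positive $\lambda,D$ we say that $(\lambda,D)\text{-dim}(X)\le n$ if $X$ can be colored in at most $n+1$ colors so that every monochromatic $\lambda$-cluster has diameter at most $D$; $(\lambda,D)\text{-dim}(X)$ is the smallest such $n$. Put $d_X(\lambda)=\inf\{(\lambda,D)\text{-dim}(X)\mid D\in\mathbb R_+\}$. Two non-decreasing functions $f,g:\mathbb R_+\to\mathbb R_+$ have the same growth if there are positive constants $a,c$ such that $f(at)\ge g(t)-c$ and $g(at)\ge f(t)-c$ for all $t$; this is an equivalence relation, and the equivalence class of a function is called its growth.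 The dimension growth of $X$ is the growth of the function $d_X(\lambda)$. It is exponential if it is the growth of the exponential function $e^{\lambda}$.
   Formalization: For arbitrary graphs the dimension growth is only shown to be at least exponential; that it is exactly exponential is shown when vertex degrees are bounded, since without some such assumption the dimension growth can be infinite or faster than exponential. *)

theory Defs
  imports "HOL-Library.Extended_Real"
begin

text \<open>Graphs are undirected; loops are allowed, multiple edges are not represented. Neither
affects distances or boundaries.\<close>

record 'a ugraph =
  verts :: "'a set"
  edges :: "'a set set"

definition is_graph :: "'a ugraph \<Rightarrow> bool" where
  "is_graph G \<longleftrightarrow> (\<forall>e\<in>edges G. \<exists>u\<in>verts G. \<exists>v\<in>verts G. e = {u, v})"

definition adj :: "'a ugraph \<Rightarrow> 'a \<Rightarrow> 'a \<Rightarrow> bool" where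
  "adj G u v \<longleftrightarrow> {u, v} \<in> edges G"

definition is_subgraph :: "'a ugraph \<Rightarrow> 'a ugraph \<Rightarrow> bool" where
  "is_subgraph H G \<longleftrightarrow> is_graph H \<and> verts H \<subseteq> verts G \<and> edges H \<subseteq> edges G"

definition edge_path :: "'a ugraph \<Rightarrow> 'a \<Rightarrow> 'a list \<Rightarrow> 'a \<Rightarrow> bool" where
  "edge_path G u p v \<longleftrightarrow>
     p \<noteq> [] \<and> hd p = u \<and> last p = v \<and> set p \<subseteq> verts G \<and> successively (adj G) p"

text \<open>The path metric. Vertices in different components are at distance \<open>\<infinity>\<close>, so that
no connectedness has to be assumed; on a connected graph this is an ordinary metric.\<close>

definition graph_dist :: "'a ugraph \<Rightarrow> 'a \<Rightarrow> 'a \<Rightarrow> ereal" where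
  "graph_dist G u v = (INF p\<in>{p. edge_path G u p v}. ereal (real (length p - 1)))"

definition boundary :: "'a ugraph \<Rightarrow> 'a set \<Rightarrow> 'a set" where
  "boundary G A = {v \<in> verts G. v \<notin> A \<and> (\<exists>u\<in>A. adj G u v)}"

definition bounded_degree :: "'a ugraph \<Rightarrow> bool" where
  "bounded_degree G \<longleftrightarrow>
     (\<exists>k. \<forall>v\<in>verts G. finite {w. adj G v w} \<and> card {w. adj G v w} \<le> k)"

text \<open>In the following a space is given by its set of points \<open>X\<close> and its distance
function \<open>d\<close>. The diameter of the empty set is \<open>-\<infinity>\<close>.\<close>

definition set_diam :: "('a \<Rightarrow> 'a \<Rightarrow> ereal) \<Rightarrow> 'a set \<Rightarrow> ereal" where
  "set_diam d S = (SUP x\<in>S. SUP y\<in>S. d x y)"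

definition lpath :: "('a \<Rightarrow> 'a \<Rightarrow> ereal) \<Rightarrow> real \<Rightarrow> 'a \<Rightarrow> 'a list \<Rightarrow> 'a \<Rightarrow> bool" where
  "lpath d l x zs y \<longleftrightarrow>
     zs \<noteq> [] \<and> hd zs = x \<and> last zs = y \<and> successively (\<lambda>u v. d u v \<le> ereal l) zs"

definition lcluster :: "('a \<Rightarrow> 'a \<Rightarrow> ereal) \<Rightarrow> real \<Rightarrow> 'a set \<Rightarrow> bool" where
  "lcluster d l S \<longleftrightarrow> (\<forall>x\<in>S. \<forall>y\<in>S. \<exists>zs. lpath d l x zs y \<and> set zs \<subseteq> S)"

definition ld_dim_le ::
    "'a set \<Rightarrow> ('a \<Rightarrow> 'a \<Rightarrow> ereal) \<Rightarrow> real \<Rightarrow> real \<Rightarrow> nat \<Rightarrow> bool" where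
  "ld_dim_le X d l D n \<longleftrightarrow>
     (\<exists>col :: 'a \<Rightarrow> nat. col ` X \<subseteq> {..n} \<and>
        (\<forall>S\<subseteq>X. lcluster d l S \<and> (\<forall>x\<in>S. \<forall>y\<in>S. col x = col y) \<longrightarrow> set_diam d S \<le> ereal D))"

text \<open>The value is \<open>\<infinity>\<close> if there is no such \<open>n\<close>.\<close>

definition ld_dim :: "'a set \<Rightarrow> ('a \<Rightarrow> 'a \<Rightarrow> ereal) \<Rightarrow> real \<Rightarrow> real \<Rightarrow> enat" where
  "ld_dim X d l D = Inf {enat n | n. ld_dim_le X d l D n}"

definition dim_fun :: "'a set \<Rightarrow> ('a \<Rightarrow> 'a \<Rightarrow> ereal) \<Rightarrow> real \<Rightarrow> ereal" where
  "dim_fun X d l = ereal_of_enat (INF D\<in>{0<..}. ld_dim X d l D)"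

text \<open>Functions on the positive reals are represented by functions on all reals, of which only
the values at positive arguments are relevant. The value \<open>\<infinity>\<close> is admitted because
\<^const>\<open>dim_fun\<close> can take it; a function with the same growth as a finite-valued one is
itself finite-valued.\<close>

definition growth_function :: "(real \<Rightarrow> ereal) \<Rightarrow> bool" where
  "growth_function f \<longleftrightarrow> mono_on {0<..} f \<and> (\<forall>t>0. 0 \<le> f t)"

definition same_growth :: "(real \<Rightarrow> ereal) \<Rightarrow> (real \<Rightarrow> ereal) \<Rightarrow> bool" where
  "same_growth f g \<longleftrightarrow>
     (\<exists>a>0. \<exists>c>0. \<forall>t>0. f (a * t) \<ge> g t - ereal c \<and> g (a * t) \<ge> f t - ereal c)"

definition growth :: "(real \<Rightarrow> ereal) \<Rightarrow> (real \<Rightarrow> ereal) set" where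
  "growth f = {g. growth_function g \<and> same_growth f g}"

definition dimension_growth :: "'a set \<Rightarrow> ('a \<Rightarrow> 'a \<Rightarrow> ereal) \<Rightarrow> (real \<Rightarrow> ereal) set" where
  "dimension_growth X d = growth (dim_fun X d)"

definition exponential_dimension_growth :: "'a set \<Rightarrow> ('a \<Rightarrow> 'a \<Rightarrow> ereal) \<Rightarrow> bool" where
  "exponential_dimension_growth X d \<longleftrightarrow>
     dimension_growth X d = growth (\<lambda>t. ereal (exp t))"

text \<open>One half of the relation \<^const>\<open>same_growth\<close> to the exponential function.\<close>

definition at_least_exponential_dimension_growth ::
    "'a set \<Rightarrow> ('a \<Rightarrow> 'a \<Rightarrow> ereal) \<Rightarrow> bool" where
  "at_least_exponential_dimension_growth X d \<longleftrightarrow>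
     (\<exists>a>0. \<exists>c>0. \<forall>t>0. dim_fun X d (a * t) \<ge> ereal (exp t) - ereal c)"

end

theory Submission
  imports Defs
begin

text \<open>If the vertices are coloured with \<open>n + 1\<close> colours so that monochromatic \<open>\<lambda>\<close>-clusters have
diameter at most \<open>D\<close>, then the combinatorial \<open>\<lfloor>\<lambda>/2\<rfloor>\<close>-neighbourhoods in \<open>G\<^sub>r\<close>, \<open>r = D + \<lambda>\<close>, of the clusters
of one colour are pairwise disjoint, while the boundary condition makes each of them
\<open>(1 + \<epsilon>)\<^bsup>\<lfloor>\<lambda>/2\<rfloor>\<^esup>\<close> times larger than its cluster. Hence every colour class of \<open>G\<^sub>r\<close> has density at most
\<open>(1 + \<epsilon>)\<^bsup>-\<lfloor>\<lambda>/2\<rfloor>\<^esup>\<close>, and \<open>n + 1 \<ge> (1 + \<epsilon>)\<^bsup>\<lfloor>\<lambda>/2\<rfloor>\<^esup>\<close>. Conversely, if degrees are bounded by \<open>k\<close>, then a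
greedy colouring separates all distinct points at distance at most \<open>\<lambda>\<close> using at most
\<open>(k + 1)\<^bsup>\<lfloor>\<lambda>\<rfloor>\<^esup> + 1\<close> colours.\<close>

section \<open>The path metric and neighbourhoods\<close>

lemma adj_sym: "adj G u v \<longleftrightarrow> adj G v u"
  by (simp add: adj_def insert_commute)

lemma edge_path_rev:
  assumes "edge_path G u p v"
  shows "edge_path G v (rev p) u"
proof -
  have "successively (\<lambda>x y. adj G y x) p"
    using assms adj_sym[of G] by (auto simp: edge_path_def elim: successively_mono)
  then show ?thesis
    using assms by (auto simp: edge_path_def hd_rev last_rev successively_rev)
qed

text \<open>\<open>tl q\<close> drops the second copy of the shared vertex \<open>v\<close>, so the
  numbers of edges add exactly.\<close>

lemma edge_path_join:
  assumes "edge_path G u p v" "edge_path G v q w"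
  shows "edge_path G u (p @ tl q) w"
    and "length (p @ tl q) - 1 = (length p - 1) + (length q - 1)"
proof -
  obtain q' where q: "q = v # q'"
    using assms(2) by (cases q) (auto simp: edge_path_def)
  show "edge_path G u (p @ tl q) w"
    using assms unfolding edge_path_def q
    by (cases q') (auto simp: successively_append_iff)
  show "length (p @ tl q) - 1 = (length p - 1) + (length q - 1)"
    using assms unfolding edge_path_def by (cases p) (auto simp: q)
qed

lemma graph_dist_le_path:
  "edge_path G u p v \<Longrightarrow> graph_dist G u v \<le> ereal (real (length p - 1))"
  unfolding graph_dist_def by (rule INF_lower) simp

text \<open>Path lengths are natural numbers, so the infimum over a non-empty set of paths is a
  minimum; over the empty set it is infinite.\<close>

lemma graph_dist_attained:
  assumes "graph_dist G u v \<noteq> \<infinity>"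
  obtains p where "edge_path G u p v" "graph_dist G u v = ereal (real (length p - 1))"
proof -
  have ex: "\<exists>p. edge_path G u p v"
  proof (rule ccontr)
    assume "\<nexists>p. edge_path G u p v"
    then have "graph_dist G u v = \<infinity>"
      unfolding graph_dist_def by (simp add: top_ereal_def)
    with assms show False by simp
  qed
  obtain p where p: "edge_path G u p v"
    and least: "\<And>q. edge_path G u q v \<Longrightarrow> length p \<le> length q"
    using ex_has_least_nat[of "\<lambda>p. edge_path G u p v" _ length] ex by blast
  have "ereal (real (length p - 1)) \<le> graph_dist G u v"
    unfolding graph_dist_def using least by (auto intro!: INF_greatest diff_le_mono)
  with graph_dist_le_path[OF p] p that show ?thesis by (metis order.antisym)
qed

lemma graph_dist_sym: "graph_dist G u v = graph_dist G v u"
proof -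
  have "graph_dist G u v \<le> graph_dist G v u" for u v
    unfolding graph_dist_def[of G v u]
    using graph_dist_le_path[OF edge_path_rev] by (auto intro!: INF_greatest)
  then show ?thesis by (metis order.antisym)
qed

lemma graph_dist_self:
  assumes "v \<in> verts G"
  shows "graph_dist G v v \<le> 0"
  using graph_dist_le_path[of G v "[v]" v] assms by (simp add: edge_path_def zero_ereal_def)

lemma graph_dist_adj:
  assumes "u \<in> verts G" "v \<in> verts G" "adj G u v"
  shows "graph_dist G u v \<le> 1"
  using graph_dist_le_path[of G u "[u, v]" v] assms by (simp add: edge_path_def one_ereal_def)

text \<open>Real bounds force both distances to be finite, so shortest paths exist and can be
  concatenated.\<close>

lemma graph_dist_triangle:
  assumes "graph_dist G u v \<le> ereal a" "graph_dist G v w \<le> ereal b"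
  shows "graph_dist G u w \<le> ereal (a + b)"
proof -
  have "graph_dist G u v \<noteq> \<infinity>" using assms(1) by auto
  then obtain p where p: "edge_path G u p v" "graph_dist G u v = ereal (real (length p - 1))"
    by (rule graph_dist_attained)
  have "graph_dist G v w \<noteq> \<infinity>" using assms(2) by auto
  then obtain q where q: "edge_path G v q w" "graph_dist G v w = ereal (real (length q - 1))"
    by (rule graph_dist_attained)
  have "graph_dist G u w \<le> ereal (real (length (p @ tl q) - 1))"
    by (rule graph_dist_le_path) (rule edge_path_join[OF p(1) q(1)])
  also have "\<dots> \<le> ereal (a + b)"
    unfolding edge_path_join(2)[OF p(1) q(1)] using assms p(2) q(2) by simp
  finally show ?thesis .
qed

section \<open>Closed neighbourhoods and their iterates\<close>

definition nbhd :: "'a ugraph \<Rightarrow> 'a set \<Rightarrow> 'a set" where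
  "nbhd G A = A \<union> boundary G A"

lemma nbhd_pow_subset:
  assumes "A \<subseteq> verts G"
  shows "(nbhd G ^^ k) A \<subseteq> verts G"
  using assms by (induction k) (auto simp: nbhd_def boundary_def)

text \<open>Neighbourhoods are taken in \<open>H\<close>, distances in \<open>G\<close>: edges of
  \<open>H\<close> are edges of \<open>G\<close>, so each step costs at most 1.\<close>

lemma nbhd_pow_dist:
  assumes "is_subgraph H G" "A \<subseteq> verts H" "x \<in> (nbhd H ^^ k) A"
  shows "\<exists>c\<in>A. graph_dist G c x \<le> ereal (real k)"
  using assms(3)
proof (induction k arbitrary: x)
  case 0
  then show ?case
    using graph_dist_self[of x G] assms(1,2)
    by (auto simp: is_subgraph_def zero_ereal_def intro!: bexI[of _ x])
next
  case (Suc k)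
  have "x \<in> nbhd H ((nbhd H ^^ k) A)" using Suc.prems by simp
  then consider "x \<in> (nbhd H ^^ k) A"
    | u where "u \<in> (nbhd H ^^ k) A" "adj H u x" "x \<in> verts H"
    by (auto simp: nbhd_def boundary_def)
  then show ?case
  proof cases
    case 1
    then obtain c where "c \<in> A" "graph_dist G c x \<le> ereal (real k)" using Suc.IH by blast
    moreover have "ereal (real k) \<le> ereal (real (Suc k))" by simp
    ultimately show ?thesis using order_trans by blast
  next
    case 2
    then obtain c where c: "c \<in> A" "graph_dist G c u \<le> ereal (real k)" using Suc.IH by blast
    have "u \<in> verts H" using 2(1) nbhd_pow_subset[OF assms(2)] by blast
    then have "graph_dist G u x \<le> ereal 1"
      using 2 assms(1) graph_dist_adj[of u G x] by (auto simp: is_subgraph_def adj_def one_ereal_def)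
    from graph_dist_triangle[OF c(2) this] c(1) show ?thesis
      by (auto simp: add.commute)
  qed
qed

lemma edge_path_nbhd_pow:
  assumes "edge_path G u p v"
  shows "v \<in> (nbhd G ^^ (length p - 1)) {u}"
  using assms
proof (induction p arbitrary: v rule: rev_induct)
  case Nil
  then show ?case by (simp add: edge_path_def)
next
  case (snoc w p)
  have [simp]: "w = v" using snoc.prems by (simp add: edge_path_def)
  show ?case
  proof (cases "p = []")
    case True
    with snoc.prems show ?thesis by (simp add: edge_path_def)
  next
    case False
    have p: "edge_path G u p (last p)" and a: "adj G (last p) v" "v \<in> verts G"
      using snoc.prems False by (auto simp: edge_path_def successively_append_iff)
    have len: "length (p @ [w]) - 1 = Suc (length p - 1)" using False by (cases p) auto
    show ?thesis unfolding len using snoc.IH[OF p] a by (auto simp: nbhd_def boundary_def)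
  qed
qed

lemma nbhd_pow_mono:
  assumes "i \<le> j"
  shows "(nbhd G ^^ i) A \<subseteq> (nbhd G ^^ j) A"
  using assms by (induction rule: dec_induct) (auto simp: nbhd_def)

text \<open>Shortest paths have integer length. This lets degree bounds control the size of metric
  balls.\<close>

lemma graph_dist_le_imp_nbhd_pow:
  assumes "graph_dist G u v \<le> ereal l"
  shows "v \<in> (nbhd G ^^ nat \<lfloor>l\<rfloor>) {u}"
proof -
  have "graph_dist G u v \<noteq> \<infinity>" using assms by auto
  then obtain p where p: "edge_path G u p v" "graph_dist G u v = ereal (real (length p - 1))"
    by (rule graph_dist_attained)
  have "real (length p - 1) \<le> l" using assms unfolding p(2) by simp
  then have "length p - 1 \<le> nat \<lfloor>l\<rfloor>" by (simp add: le_nat_floor)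
  from subsetD[OF nbhd_pow_mono[OF this] edge_path_nbhd_pow[OF p(1)]] show ?thesis .
qed

text \<open>Each step adds at most \<open>k\<close> neighbours per vertex, so it multiplies the
  cardinality by at most \<open>k + 1\<close>.\<close>

lemma finite_card_nbhd_pow:
  assumes deg: "\<forall>v\<in>verts G. finite {w. adj G v w} \<and> card {w. adj G v w} \<le> k"
    and "v \<in> verts G"
  shows "finite ((nbhd G ^^ m) {v}) \<and> card ((nbhd G ^^ m) {v}) \<le> (k + 1) ^ m"
proof (induction m)
  case 0
  then show ?case by simp
next
  case (Suc m)
  define B where "B = (nbhd G ^^ m) {v}"
  have B: "finite B" "card B \<le> (k + 1) ^ m" using Suc by (auto simp: B_def)
  have BV: "B \<subseteq> verts G" unfolding B_def using nbhd_pow_subset[of "{v}" G m] assms(2) by simp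
  have sub: "nbhd G B \<subseteq> B \<union> (\<Union>u\<in>B. {w. adj G u w})"
    by (auto simp: nbhd_def boundary_def)
  have fin: "finite (B \<union> (\<Union>u\<in>B. {w. adj G u w}))" using B(1) BV deg by auto
  have "card (nbhd G B) \<le> card B + card (\<Union>u\<in>B. {w. adj G u w})"
    using card_mono[OF fin sub] card_Un_le order_trans by blast
  also have "card (\<Union>u\<in>B. {w. adj G u w}) \<le> (\<Sum>u\<in>B. card {w. adj G u w})"
    by (rule card_UN_le[OF B(1)])
  also have "\<dots> \<le> (\<Sum>u\<in>B. k)" using deg BV by (intro sum_mono) auto
  also have "card B + (\<Sum>u\<in>B. k) = (k + 1) * card B" by simp
  also have "\<dots> \<le> (k + 1) * (k + 1) ^ m" using B(2) by (rule mult_le_mono2)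
  finally show ?case using finite_subset[OF sub fin] by (simp add: B_def)
qed

section \<open>Clusters\<close>

text \<open>The \<open>l\<close>-components of \<open>B\<close> are the equivalence classes of this relation.\<close>

definition lconn :: "('a \<Rightarrow> 'a \<Rightarrow> ereal) \<Rightarrow> real \<Rightarrow> 'a set \<Rightarrow> ('a \<times> 'a) set" where
  "lconn d l B = {(x, y). \<exists>zs. lpath d l x zs y \<and> set zs \<subseteq> B}"

lemma lpath_mem: "lpath d l x zs y \<Longrightarrow> x \<in> set zs \<and> y \<in> set zs"
  by (auto simp: lpath_def)

lemma equiv_lconn:
  assumes sym: "\<And>x y. d x y = d y x" and refl: "\<And>x. x \<in> B \<Longrightarrow> d x x \<le> ereal l"
  shows "equiv B (lconn d l B)"
proof (rule equivI)
  show "lconn d l B \<subseteq> B \<times> B"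
    using lpath_mem by (fastforce simp: lconn_def)
  show "refl_on B (lconn d l B)"
  proof (rule refl_onI)
    fix x assume "x \<in> B"
    then have "lpath d l x [x] x \<and> set [x] \<subseteq> B" by (simp add: lpath_def)
    then show "(x, x) \<in> lconn d l B" unfolding lconn_def by blast
  qed
  show "sym (lconn d l B)"
  proof (rule symI)
    fix x y assume "(x, y) \<in> lconn d l B"
    then obtain zs where "lpath d l x zs y" "set zs \<subseteq> B" by (auto simp: lconn_def)
    then have "lpath d l y (rev zs) x \<and> set (rev zs) \<subseteq> B"
      by (simp add: lpath_def hd_rev last_rev successively_rev sym)
    then show "(y, x) \<in> lconn d l B" unfolding lconn_def by blast
  qed
  show "trans (lconn d l B)"
  proof (rule transI)
    fix x y z assume "(x, y) \<in> lconn d l B" "(y, z) \<in> lconn d l B"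
    then obtain zs ws where *: "lpath d l x zs y" "set zs \<subseteq> B" "lpath d l y ws z" "set ws \<subseteq> B"
      by (auto simp: lconn_def)
    \<comment> \<open>The concatenation \<open>zs @ ws\<close> contains \<open>y\<close> twice in a
      row, so the step from \<open>y\<close> to itself must be admissible.\<close>
    have "d y y \<le> ereal l" using lpath_mem[OF *(1)] *(2) refl by auto
    with * have "lpath d l x (zs @ ws) z \<and> set (zs @ ws) \<subseteq> B"
      by (auto simp: lpath_def successively_append_iff)
    then show "(x, z) \<in> lconn d l B" unfolding lconn_def by blast
  qed
qed

lemma lpath_imp_lconn:
  assumes "lpath d l x zs y" "set zs \<subseteq> B" "w \<in> set zs"
  shows "(x, w) \<in> lconn d l B"
proof -
  obtain as bs where zs: "zs = (as @ [w]) @ bs" using split_list[OF assms(3)] by auto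
  have "successively (\<lambda>u v. d u v \<le> ereal l) (as @ [w])"
    using assms(1) unfolding lpath_def zs successively_append_iff by blast
  moreover have "hd (as @ [w]) = x" using assms(1) by (cases as) (auto simp: lpath_def zs)
  ultimately have "lpath d l x (as @ [w]) w \<and> set (as @ [w]) \<subseteq> B"
    using assms(2) by (auto simp: lpath_def zs)
  then show ?thesis unfolding lconn_def by blast
qed

text \<open>\<open>lconn\<close> provides paths inside \<open>B\<close>, whereas
  \<open>lcluster\<close> demands paths inside the class. Prefixes of a path in \<open>B\<close>
  show that it never leaves the class of its first point.\<close>

lemma lcluster_lconn_class:
  assumes eq: "equiv B (lconn d l B)" and C: "C \<in> B // lconn d l B"
  shows "lcluster d l C"
  unfolding lcluster_def
proof (intro ballI)
  fix x y assume xy: "x \<in> C" "y \<in> C"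
  then have "(x, y) \<in> lconn d l B"
    using quotient_eq_iff[OF eq C C] by blast
  then obtain zs where zs: "lpath d l x zs y" "set zs \<subseteq> B" by (auto simp: lconn_def)
  have "C = lconn d l B `` {x}"
    using C xy(1) eq by (metis quotientE equiv_class_eq_iff Image_singleton_iff)
  then have "set zs \<subseteq> C" using lpath_imp_lconn[OF zs] by blast
  with zs(1) show "\<exists>zs. lpath d l x zs y \<and> set zs \<subseteq> C" by blast
qed

text \<open>Read contrapositively: distinct components are more than \<open>l\<close> apart, which
  keeps their neighbourhoods disjoint.\<close>

lemma lconn_class_eqI:
  assumes eq: "equiv B (lconn d l B)"
    and "C \<in> B // lconn d l B" "C' \<in> B // lconn d l B"
    and "x \<in> C" "y \<in> C'" "d x y \<le> ereal l"
  shows "C = C'"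
proof -
  have "x \<in> B" "y \<in> B" using assms in_quotient_imp_subset[OF eq] by blast+
  then have "lpath d l x [x, y] y \<and> set [x, y] \<subseteq> B" using assms(6) by (simp add: lpath_def)
  then have "(x, y) \<in> lconn d l B" unfolding lconn_def by blast
  with quotient_eqI[OF eq] assms show ?thesis by blast
qed

section \<open>The lower bound\<close>

text \<open>Each step adds the boundary and so gains a factor \<open>1 + \<epsilon>\<close>, as long
  as the set reached has diameter at most \<open>r\<close>. The \<open>j\<close>-fold neighbourhood
  of \<open>C\<close> has diameter at most \<open>D + 2 * j\<close>, whence the condition on
  \<open>r\<close>.\<close>

lemma nbhd_pow_card_ge:
  fixes \<epsilon> r :: real
  assumes H: "is_subgraph H G" "finite (verts H)" and \<epsilon>: "\<epsilon> > 0"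
    and exp: "\<And>A. A \<subseteq> verts H \<Longrightarrow> set_diam (graph_dist G) A \<le> ereal r \<Longrightarrow>
           real (card (boundary H A)) \<ge> \<epsilon> * real (card A)"
    and C: "C \<subseteq> verts H" "set_diam (graph_dist G) C \<le> ereal D"
    and r: "D + 2 * real k \<le> r"
  shows "real (card ((nbhd H ^^ k) C)) \<ge> (1 + \<epsilon>) ^ k * real (card C)"
  using r
proof (induction k)
  case 0
  then show ?case by simp
next
  case (Suc k)
  define N where "N = (nbhd H ^^ k) C"
  have N: "N \<subseteq> verts H" unfolding N_def by (rule nbhd_pow_subset[OF C(1)])
  have "graph_dist G x y \<le> ereal r" if xy: "x \<in> N" "y \<in> N" for x y
  proof -
    obtain c where c: "c \<in> C" "graph_dist G c x \<le> ereal (real k)"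
      using nbhd_pow_dist[OF H(1) C(1) xy(1)[unfolded N_def]] by blast
    obtain c' where c': "c' \<in> C" "graph_dist G c' y \<le> ereal (real k)"
      using nbhd_pow_dist[OF H(1) C(1) xy(2)[unfolded N_def]] by blast
    have "graph_dist G c c' \<le> set_diam (graph_dist G) C"
      unfolding set_diam_def using c(1) c'(1) by (meson SUP_upper2 order_refl)
    with C(2) have "graph_dist G c c' \<le> ereal D" by (rule order_trans[rotated])
    from graph_dist_triangle[OF this c'(2)]
    have "graph_dist G x y \<le> ereal (real k + (D + real k))"
      using graph_dist_triangle c(2) graph_dist_sym by metis
    also have "\<dots> \<le> ereal r" using Suc.prems by simp
    finally show ?thesis .
  qed
  then have "set_diam (graph_dist G) N \<le> ereal r"
    unfolding set_diam_def by (auto intro!: SUP_least)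
  from exp[OF N this] have bd: "real (card (boundary H N)) \<ge> \<epsilon> * real (card N)" .
  have fin: "finite N" "finite (boundary H N)"
    using N H(2) finite_subset by (auto simp: boundary_def)
  have "(1 + \<epsilon>) ^ Suc k * real (card C) = (1 + \<epsilon>) * ((1 + \<epsilon>) ^ k * real (card C))" by simp
  also have "\<dots> \<le> (1 + \<epsilon>) * real (card N)"
    using Suc \<epsilon> unfolding N_def by (intro mult_left_mono) auto
  also have "\<dots> \<le> real (card N + card (boundary H N))" using bd by (simp add: algebra_simps)
  also have "\<dots> = real (card (nbhd H N))"
    unfolding nbhd_def using fin by (subst card_Un_disjoint) (auto simp: boundary_def)
  finally show ?case by (simp add: N_def)
qed

lemma colour_class_card_le:
  fixes \<epsilon> l D :: real
  assumes H: "is_subgraph H G" "finite (verts H)" and \<epsilon>: "\<epsilon> > 0" and l: "l \<ge> 0"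
    and exp: "\<And>A. A \<subseteq> verts H \<Longrightarrow> set_diam (graph_dist G) A \<le> ereal (D + l) \<Longrightarrow>
           real (card (boundary H A)) \<ge> \<epsilon> * real (card A)"
    and B: "B \<subseteq> verts H"
    and clusters: "\<And>S. S \<subseteq> B \<Longrightarrow> lcluster (graph_dist G) l S \<Longrightarrow> set_diam (graph_dist G) S \<le> ereal D"
  shows "(1 + \<epsilon>) ^ nat \<lfloor>l / 2\<rfloor> * real (card B) \<le> real (card (verts H))"
proof -
  \<comment> \<open>The largest radius with \<open>2 * k \<le> l\<close>. It serves twice:
    neighbourhoods of sets more than \<open>l\<close> apart cannot meet, and
    \<open>D + 2 * k\<close> stays within the diameter \<open>D + l\<close> for which expansion is
    assumed.\<close>
  define k where "k = nat \<lfloor>l / 2\<rfloor>"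
  have k: "2 * real k \<le> l" unfolding k_def using l by linarith
  define E where "E = lconn (graph_dist G) l B"
  have "graph_dist G x x \<le> ereal l" if "x \<in> B" for x
    using graph_dist_self[of x G] that B H(1) l unfolding is_subgraph_def
    by (metis ereal_less_eq(3) order_trans subsetD zero_ereal_def)
  then have eq: "equiv B E" unfolding E_def by (intro equiv_lconn graph_dist_sym)
  have finB: "finite B" using B H(2) finite_subset by blast
  have classB: "C \<subseteq> B" if "C \<in> B // E" for C
    using in_quotient_imp_subset[OF eq that] .
  have finE: "finite (B // E)" using finB classB by (meson PowI finite_Pow_iff finite_subset subsetI)
  define N where "N C = (nbhd H ^^ k) C" for C
  have NH: "N C \<subseteq> verts H" if "C \<in> B // E" for C
    unfolding N_def by (rule nbhd_pow_subset) (use classB that B in blast)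
  have disj: "N C \<inter> N C' = {}" if CC: "C \<in> B // E" "C' \<in> B // E" "C \<noteq> C'" for C C'
  proof (rule ccontr)
    assume "N C \<inter> N C' \<noteq> {}"
    then obtain x where x: "x \<in> N C" "x \<in> N C'" by blast
    have sub: "C \<subseteq> verts H" "C' \<subseteq> verts H" using classB CC B by blast+
    obtain c where c: "c \<in> C" "graph_dist G c x \<le> ereal (real k)"
      using nbhd_pow_dist[OF H(1) sub(1) x(1)[unfolded N_def]] by blast
    obtain c' where c': "c' \<in> C'" "graph_dist G c' x \<le> ereal (real k)"
      using nbhd_pow_dist[OF H(1) sub(2) x(2)[unfolded N_def]] by blast
    have "graph_dist G c c' \<le> ereal (real k + real k)"
      using graph_dist_triangle c(2) c'(2) graph_dist_sym by metis
    also have "\<dots> \<le> ereal l" using k by simp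
    finally have "C = C'"
      using lconn_class_eqI CC c(1) c'(1) eq unfolding E_def by metis
    with CC show False by simp
  qed
  \<comment> \<open>The components partition \<open>B\<close>, while their enlarged copies are
    packed disjointly into \<open>verts H\<close>; comparing the two sums gives the density
    bound.\<close>
  have "card B = (\<Sum>C\<in>B // E. card C)"
    using card_Union_disjoint[of "B // E"] Union_quotient[OF eq] quotient_disj[OF eq] classB finB
    by (metis disjnt_def finite_subset pairwiseI)
  then have "(1 + \<epsilon>) ^ k * real (card B) = (\<Sum>C\<in>B // E. (1 + \<epsilon>) ^ k * real (card C))"
    by (simp add: sum_distrib_left)
  also have "\<dots> \<le> (\<Sum>C\<in>B // E. real (card (N C)))"
  proof (rule sum_mono)
    fix C assume C: "C \<in> B // E"
    have "set_diam (graph_dist G) C \<le> ereal D"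
      using clusters[OF classB[OF C]] lcluster_lconn_class eq C unfolding E_def by blast
    then show "(1 + \<epsilon>) ^ k * real (card C) \<le> real (card (N C))"
      unfolding N_def using nbhd_pow_card_ge[OF H \<epsilon> exp, where C = C and D = D and k = k] classB[OF C] B k by auto
  qed
  also have "\<dots> = real (card (\<Union>C\<in>B // E. N C))"
    using finE NH H(2) disj by (subst card_UN_disjoint) (auto intro: finite_subset)
  also have "\<dots> \<le> real (card (verts H))"
    using NH H(2) by (auto intro!: card_mono)
  finally show ?thesis unfolding k_def .
qed

text \<open>The density bound is summed over the \<open>n + 1\<close> colours, and
  \<open>card (verts H)\<close>, positive as \<open>H\<close> is finite and non-empty, cancels.
  Clusters in \<open>H\<close> are measured by the metric of \<open>G\<close>, so a colouring of
  \<open>G\<close> restricts to \<open>H\<close>.\<close>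

lemma ld_dim_le_lower_bound:
  fixes \<epsilon> l D :: real
  assumes H: "is_subgraph H G" "finite (verts H)" "verts H \<noteq> {}" and \<epsilon>: "\<epsilon> > 0" and l: "l \<ge> 0"
    and exp: "\<And>A. A \<subseteq> verts H \<Longrightarrow> set_diam (graph_dist G) A \<le> ereal (D + l) \<Longrightarrow>
           real (card (boundary H A)) \<ge> \<epsilon> * real (card A)"
    and dim: "ld_dim_le (verts G) (graph_dist G) l D n"
  shows "(1 + \<epsilon>) ^ nat \<lfloor>l / 2\<rfloor> \<le> real n + 1"
proof -
  obtain col :: "'a \<Rightarrow> nat" where col: "col ` verts G \<subseteq> {..n}"
    and clusters: "\<forall>S\<subseteq>verts G. lcluster (graph_dist G) l S \<and> (\<forall>x\<in>S. \<forall>y\<in>S. col x = col y) \<longrightarrow>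
      set_diam (graph_dist G) S \<le> ereal D"
    using dim unfolding ld_dim_le_def by (elim exE conjE)
  have HG: "verts H \<subseteq> verts G" using H(1) by (simp add: is_subgraph_def)
  define B where "B i = {v \<in> verts H. col v = i}" for i
  have "verts H = (\<Union>i\<le>n. B i)" using col HG by (auto simp: B_def)
  moreover have "card (\<Union>i\<le>n. B i) = (\<Sum>i\<le>n. card (B i))"
    using H(2) by (intro card_UN_disjoint) (auto simp: B_def)
  ultimately have "real (card (verts H)) = (\<Sum>i\<le>n. real (card (B i)))" by simp
  then have "(1 + \<epsilon>) ^ nat \<lfloor>l / 2\<rfloor> * real (card (verts H)) =
      (\<Sum>i\<le>n. (1 + \<epsilon>) ^ nat \<lfloor>l / 2\<rfloor> * real (card (B i)))" by (simp add: sum_distrib_left)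
  also have "\<dots> \<le> (\<Sum>i\<le>n. real (card (verts H)))"
  proof (rule sum_mono)
    fix i
    show "(1 + \<epsilon>) ^ nat \<lfloor>l / 2\<rfloor> * real (card (B i)) \<le> real (card (verts H))"
    proof (rule colour_class_card_le[OF H(1,2) \<epsilon> l exp])
      show "set_diam (graph_dist G) S \<le> ereal D"
        if "S \<subseteq> B i" "lcluster (graph_dist G) l S" for S
        using that HG by (intro clusters[rule_format]) (auto simp: B_def)
    qed (auto simp: B_def)
  qed
  also have "\<dots> = (real n + 1) * real (card (verts H))" by simp
  finally show ?thesis using H(2,3) by (simp add: card_gt_0_iff)
qed

section \<open>Dimension functions and growth\<close>

text \<open>A smaller scale admits fewer paths and hence fewer clusters, so the same colouring
  works.\<close>

lemma ld_dim_le_mono: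
  assumes "ld_dim_le X d l D m" "m \<le> n" "l' \<le> l"
  shows "ld_dim_le X d l' D n"
proof -
  have "lcluster d l S" if "lcluster d l' S" for S
  proof -
    have "lpath d l x zs y" if "lpath d l' x zs y" for x zs y
      using that assms(3) unfolding lpath_def
      by (auto elim!: successively_mono intro: order_trans)
    with that show ?thesis unfolding lcluster_def by blast
  qed
  with assms(1,2) show ?thesis unfolding ld_dim_le_def by (meson atMost_subset_iff order_trans)
qed

lemma dim_fun_upper:
  assumes "ld_dim_le X d l D n" "D > 0"
  shows "dim_fun X d l \<le> ereal (real n)"
proof -
  have "(INF D\<in>{0<..}. ld_dim X d l D) \<le> ld_dim X d l D" using assms(2) by (intro INF_lower) simp
  also have "\<dots> \<le> enat n" unfolding ld_dim_def using assms(1) by (intro Inf_lower) auto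
  finally have "ereal_of_enat (INF D\<in>{0<..}. ld_dim X d l D) \<le> ereal_of_enat (enat n)"
    by (simp only: ereal_of_enat_le_iff)
  then show ?thesis by (simp add: dim_fun_def)
qed

text \<open>A finite value is witnessed by a colouring: being below \<open>Suc m\<close> passes from
  an infimum to one of its members, first for \<open>D\<close> and then for
  \<open>n\<close>.\<close>

lemma dim_fun_cases:
  obtains "dim_fun X d l = \<infinity>"
  | n D where "D > 0" "ld_dim_le X d l D n" "dim_fun X d l = ereal (real n)"
proof (cases "INF D\<in>{0<..}. ld_dim X d l D")
  case infinity
  then show ?thesis using that(1) by (simp add: dim_fun_def)
next
  case (enat m)
  then have "(INF D\<in>{0<..}. ld_dim X d l D) < enat (Suc m)" by simp
  then obtain D where D: "D > 0" "ld_dim X d l D < enat (Suc m)"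
    unfolding INF_less_iff by auto
  then obtain n where "ld_dim_le X d l D n" "n < Suc m"
    unfolding ld_dim_def Inf_less_iff by auto
  then have "ld_dim_le X d l D m" by (auto intro: ld_dim_le_mono)
  with D(1) enat that(2) show ?thesis by (simp add: dim_fun_def)
qed

lemma dim_fun_mono:
  assumes "l' \<le> l"
  shows "dim_fun X d l' \<le> dim_fun X d l"
proof (cases rule: dim_fun_cases[of X d l])
  case (2 n D)
  then show ?thesis using dim_fun_upper[OF ld_dim_le_mono[OF 2(2) order_refl assms]] by simp
qed simp

section \<open>Symmetry and transitivity of having the same growth\<close>

lemma same_growthI:
  assumes "a > 0" "c > 0"
    and "\<And>t. t > 0 \<Longrightarrow> f (a * t) \<ge> g t - ereal c"
    and "\<And>t. t > 0 \<Longrightarrow> g (a * t) \<ge> f t - ereal c"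
  shows "same_growth f g"
  using assms unfolding same_growth_def by blast

lemma same_growth_sym: "same_growth f g \<Longrightarrow> same_growth g f"
  unfolding same_growth_def by blast

lemma ereal_minus_trans:
  fixes x y z :: ereal
  assumes "x \<ge> y - ereal a" "y \<ge> z - ereal b"
  shows "x \<ge> z - ereal (a + b)"
  using assms by (cases x; cases y; cases z) auto

lemma same_growth_trans:
  assumes "same_growth f g" "same_growth g h"
  shows "same_growth f h"
proof -
  obtain a c where a: "a > 0" "c > 0"
    and fg: "\<And>t. t > 0 \<Longrightarrow> f (a * t) \<ge> g t - ereal c \<and> g (a * t) \<ge> f t - ereal c"
    using assms(1) unfolding same_growth_def by blast
  obtain b c' where b: "b > 0" "c' > 0"
    and gh: "\<And>t. t > 0 \<Longrightarrow> g (b * t) \<ge> h t - ereal c' \<and> h (b * t) \<ge> g t - ereal c'"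
    using assms(2) unfolding same_growth_def by blast
  show ?thesis
  proof (rule same_growthI)
    \<comment> \<open>The scalings compose, by evaluating the first relation at \<open>b * t\<close>
      in one direction and the second at \<open>a * t\<close> in the other; the errors add.\<close>
    show "a * b > 0" "c + c' > 0" using a b by auto
    fix t :: real assume t: "t > 0"
    show "f (a * b * t) \<ge> h t - ereal (c + c')"
      using fg[of "b * t"] gh[of t] t b by (intro ereal_minus_trans) (auto simp: mult.assoc)
    show "h (a * b * t) \<ge> f t - ereal (c + c')"
      using fg[of t] gh[of "a * t"] t a ereal_minus_trans[of "g (a * t)" c' "h (b * (a * t))" "f t" c]
      by (simp add: ac_simps)
  qed
qed

lemma growth_eqI: "same_growth f g \<Longrightarrow> growth f = growth g"
  unfolding growth_def by (metis same_growth_sym same_growth_trans)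

section \<open>Greedy colourings and the upper bound\<close>

text \<open>\<open>X\<close> may be infinite, so colours are assigned by recursion along a
  well-order. At most \<open>N\<close> neighbours block at most \<open>N\<close> of the
  \<open>N + 1\<close> colours, so one is always free.\<close>

lemma greedy_colouring:
  assumes sym: "\<And>x y. R x y \<Longrightarrow> R y x"
    and deg: "\<And>x. x \<in> X \<Longrightarrow> finite {y \<in> X. R x y} \<and> card {y \<in> X. R x y} \<le> N"
  obtains col :: "'a \<Rightarrow> nat"
  where "\<And>x. x \<in> X \<Longrightarrow> col x \<le> N"
    and "\<And>x y. x \<in> X \<Longrightarrow> y \<in> X \<Longrightarrow> x \<noteq> y \<Longrightarrow> R x y \<Longrightarrow> col x \<noteq> col y"
proof -
  obtain W :: "('a \<times> 'a) set" where W: "well_order_on UNIV W" using well_order_on by blast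
  \<comment> \<open>Admissibility of the colour \<open>c\<close> at \<open>x\<close>. It depends on
    \<open>f\<close> only at predecessors of \<open>x\<close>, as the recursion principle
    requires.\<close>
  define P where "P f x c \<longleftrightarrow> (x \<in> X \<longrightarrow>
    c \<le> N \<and> (\<forall>y\<in>X. (y, x) \<in> W - Id \<and> R x y \<longrightarrow> f y \<noteq> c))" for f :: "'a \<Rightarrow> nat" and x c
  have "wf (W - Id)" using W by (simp add: well_order_on_def)
  then have "\<exists>f. \<forall>x. P f x (f x)"
  proof (rule dependent_wf_choice)
    show "P f x c = P g x c" if "\<And>z. (z, x) \<in> W - Id \<Longrightarrow> f z = g z" for f g x c
      unfolding P_def using that by metis
    show "\<exists>c. P f x c" for f x
    proof (cases "x \<in> X")
      case True
      \<comment> \<open>All neighbours are avoided, later ones included, whatever \<open>f\<close>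
        is there; the degree bound covers them all.\<close>
      define U where "U = {y \<in> X. R x y}"
      have "card (f ` U) < card {..N}"
        using deg[OF True] card_image_le[of U f] unfolding U_def by fastforce
      then have "\<not> {..N} \<subseteq> f ` U"
        using deg[OF True] unfolding U_def by (meson card_mono finite_imageI not_less)
      then obtain c where "c \<le> N" "c \<notin> f ` U" by blast
      then have "P f x c" unfolding P_def U_def by blast
      then show ?thesis ..
    qed (auto simp: P_def)
  qed
  then obtain col where col: "\<And>x. P col x (col x)" by blast
  show ?thesis
  proof (rule that)
    show "col x \<le> N" if "x \<in> X" for x using col[of x] that by (simp add: P_def)
    fix x y assume xy: "x \<in> X" "y \<in> X" "x \<noteq> y" "R x y"
    \<comment> \<open>Whichever of the two neighbours comes later was given a colour different from
      that of the earlier one.\<close>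
    then have "(x, y) \<in> W - Id \<or> (y, x) \<in> W - Id"
      using W by (auto simp: well_order_on_def linear_order_on_def total_on_def)
    then show "col x \<noteq> col y"
      using col[of x] col[of y] xy sym unfolding P_def by metis
  qed
qed

text \<open>Distinct points at distance at most \<open>l\<close> get different colours, so a
  monochromatic \<open>l\<close>-cluster has at most one point. The number of colours comes from the
  size of a ball of radius \<open>l\<close>.\<close>

lemma ld_dim_le_upper_bound:
  assumes deg: "\<forall>v\<in>verts G. finite {w. adj G v w} \<and> card {w. adj G v w} \<le> k" and D: "D \<ge> 0"
  shows "ld_dim_le (verts G) (graph_dist G) l D ((k + 1) ^ nat \<lfloor>l\<rfloor>)"
proof -
  define N where "N = (k + 1) ^ nat \<lfloor>l\<rfloor>"
  define R where "R x y \<longleftrightarrow> graph_dist G x y \<le> ereal l" for x y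
  have symR: "R y x" if "R x y" for x y using that by (simp add: R_def graph_dist_sym)
  have degR: "finite {y \<in> verts G. R x y} \<and> card {y \<in> verts G. R x y} \<le> N"
    if "x \<in> verts G" for x
  proof -
    have "{y \<in> verts G. R x y} \<subseteq> (nbhd G ^^ nat \<lfloor>l\<rfloor>) {x}"
      using graph_dist_le_imp_nbhd_pow by (auto simp: R_def)
    with finite_card_nbhd_pow[OF deg that, of "nat \<lfloor>l\<rfloor>"] show ?thesis
      unfolding N_def by (meson card_mono finite_subset order_trans)
  qed
  obtain col :: "'a \<Rightarrow> nat" where col: "\<And>x. x \<in> verts G \<Longrightarrow> col x \<le> N"
    "\<And>x y. x \<in> verts G \<Longrightarrow> y \<in> verts G \<Longrightarrow> x \<noteq> y \<Longrightarrow> R x y \<Longrightarrow> col x \<noteq> col y"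
    using greedy_colouring[of R "verts G" N, OF symR degR] by blast
  have diam: "set_diam (graph_dist G) S \<le> ereal D"
    if S: "S \<subseteq> verts G" "lcluster (graph_dist G) l S" "\<forall>x\<in>S. \<forall>y\<in>S. col x = col y" for S
  proof -
    \<comment> \<open>Consecutive points of the list are close and equally coloured, hence
      equal.\<close>
    have const: "\<forall>z\<in>set zs. z = hd zs"
      if "zs \<noteq> []" "successively R zs" "set zs \<subseteq> S" for zs
      using that
    proof (induction zs rule: induct_list012)
      case (3 x y zs)
      then have "x = y" using col(2)[of x y] S(1,3) by auto
      with 3 show ?case by auto
    qed auto
    have "graph_dist G x y \<le> ereal D" if xy: "x \<in> S" "y \<in> S" for x y
    proof -
      obtain zs where zs: "lpath (graph_dist G) l x zs y" "set zs \<subseteq> S"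
        using S(2) xy unfolding lcluster_def by blast
      then have "x = y" using const[of zs] last_in_set[of zs]
        by (auto simp: lpath_def R_def[abs_def])
      moreover have "graph_dist G x x \<le> 0" using graph_dist_self[OF subsetD[OF S(1) xy(1)]] .
      ultimately show ?thesis using D order_trans[of _ 0 "ereal D"] by simp
    qed
    then show ?thesis unfolding set_diam_def by (auto intro!: SUP_least)
  qed
  show ?thesis
    unfolding ld_dim_le_def N_def[symmetric]
  proof (intro exI[of _ col] conjI allI impI)
    show "col ` verts G \<subseteq> {..N}" using col(1) by auto
  qed (elim conjE, rule diam)
qed

text \<open>Expansion bounds the dimension function from below; the matching upper bound comes from
  the greedy colouring, which uses a uniform degree bound.\<close>

theorem theorem2p9:
  fixes G :: "'a ugraph" and \<epsilon> :: real
  assumes "is_graph G"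
    and "\<epsilon> > 0"
    and "\<forall>r::real. \<exists>H. is_subgraph H G \<and> finite (verts H) \<and> verts H \<noteq> {} \<and>
           (\<forall>A\<subseteq>verts H. set_diam (graph_dist G) A \<le> ereal r \<longrightarrow>
              real (card (boundary H A)) \<ge> \<epsilon> * real (card A))"
  shows "at_least_exponential_dimension_growth (verts G) (graph_dist G) \<and>
         (bounded_degree G \<longrightarrow> exponential_dimension_growth (verts G) (graph_dist G))"
proof -
  define f where "f = dim_fun (verts G) (graph_dist G)"
  \<comment> \<open>For \<open>l = a * t\<close> this makes
    \<open>(1 + \<epsilon>) powr (l / 2)\<close> equal to \<open>exp t * exp t\<close>. One factor
    is the target; the other absorbs the factor \<open>1 + \<epsilon>\<close> lost by rounding
    \<open>l / 2\<close> down.\<close>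
  define a where "a = 4 / ln (1 + \<epsilon>)"
  have a: "a > 0" unfolding a_def using assms(2) by simp
  have lower: "f (a * t) \<ge> ereal (exp t) - ereal (2 + \<epsilon>)" if t: "t > 0" for t
  proof (cases rule: dim_fun_cases[of "verts G" "graph_dist G" "a * t"])
    case 1
    then show ?thesis by (simp add: f_def)
  next
    case (2 n D)
    define l where "l = a * t"
    have l: "l \<ge> 0" unfolding l_def using a t by simp
    \<comment> \<open>\<open>D\<close> is known only once a colouring is given, so \<open>H\<close>
      is chosen after it; hence the need for expansion at every scale \<open>r\<close>.\<close>
    obtain H where H: "is_subgraph H G" "finite (verts H)" "verts H \<noteq> {}"
      "\<And>A. A \<subseteq> verts H \<Longrightarrow> set_diam (graph_dist G) A \<le> ereal (D + l) \<Longrightarrow>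
              real (card (boundary H A)) \<ge> \<epsilon> * real (card A)"
      using spec[OF assms(3), of "D + l"] by blast
    have n: "(1 + \<epsilon>) ^ nat \<lfloor>l / 2\<rfloor> \<le> real n + 1"
      using ld_dim_le_lower_bound[OF H(1-3) assms(2) l H(4)] 2(2) by (simp add: l_def)
    have "l / 2 - 1 \<le> real (nat \<lfloor>l / 2\<rfloor>)" by linarith
    then have "(1 + \<epsilon>) powr (l / 2 - 1) \<le> (1 + \<epsilon>) ^ nat \<lfloor>l / 2\<rfloor>"
      using assms(2) by (simp add: powr_realpow[symmetric] powr_mono)
    moreover have "(l / 2 - 1) * ln (1 + \<epsilon>) = t + t - ln (1 + \<epsilon>)"
      using assms(2) by (simp add: l_def a_def field_simps)
    then have "(1 + \<epsilon>) powr (l / 2 - 1) = exp t * exp t / (1 + \<epsilon>)"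
      using assms(2) by (simp only: powr_def exp_diff exp_add) simp
    ultimately have "exp t * exp t \<le> (1 + \<epsilon>) * (real n + 1)"
      using n assms(2) mult_left_mono[of "exp t * exp t / (1 + \<epsilon>)" "real n + 1" "1 + \<epsilon>"] by simp
    \<comment> \<open>If \<open>exp t\<close> exceeds \<open>1 + \<epsilon>\<close>, one factor
      cancels and \<open>exp t \<le> n + 1\<close> remains; otherwise the additive constant
      \<open>2 + \<epsilon>\<close> already suffices.\<close>
    have "exp t \<le> real n + 2 + \<epsilon>"
    proof (cases "exp t \<le> 1 + \<epsilon>")
      case False
      then have "(1 + \<epsilon>) * exp t \<le> exp t * exp t" by simp
      also note \<open>exp t * exp t \<le> (1 + \<epsilon>) * (real n + 1)\<close>
      finally show ?thesis using assms(2) by simp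
    qed simp
    then show ?thesis using 2(3) by (simp add: f_def)
  qed
  have c: "2 + \<epsilon> > 0" using assms(2) by simp
  have "at_least_exponential_dimension_growth (verts G) (graph_dist G)"
    unfolding at_least_exponential_dimension_growth_def f_def[symmetric]
    using lower a c by blast
  moreover have "exponential_dimension_growth (verts G) (graph_dist G)" if "bounded_degree G"
  proof -
    obtain k where k: "\<forall>v\<in>verts G. finite {w. adj G v w} \<and> card {w. adj G v w} \<le> k"
      using \<open>bounded_degree G\<close> unfolding bounded_degree_def by blast
    \<comment> \<open>\<open>same_growth\<close> demands one scaling for both inequalities. Both
      functions are monotone, so the larger of the two scalings serves.\<close>
    define b where "b = max a (ln (real k + 1))"
    have b: "b > 0" "a \<le> b" "ln (real k + 1) \<le> b" unfolding b_def using a by auto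
    have upper: "f t \<le> ereal (exp (b * t))" if t: "t > 0" for t
    proof -
      have "f t \<le> ereal (real ((k + 1) ^ nat \<lfloor>t\<rfloor>))"
        unfolding f_def by (rule dim_fun_upper[OF ld_dim_le_upper_bound[OF k, of 1]]) auto
      also have "real ((k + 1) ^ nat \<lfloor>t\<rfloor>) = (real k + 1) powr real (nat \<lfloor>t\<rfloor>)"
        by (simp add: powr_realpow add.commute)
      also have "\<dots> \<le> (real k + 1) powr t" using t by (intro powr_mono) auto
      also have "\<dots> = exp (ln (real k + 1) * t)" by (simp add: powr_def mult.commute)
      also have "\<dots> \<le> exp (b * t)" using b t by simp
      finally show ?thesis by simp
    qed
    have "same_growth f (\<lambda>t. ereal (exp t))"
    proof (rule same_growthI)
      show "b > 0" "2 + \<epsilon> > 0" using b c by auto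
      fix t :: real assume t: "t > 0"
      have "f (a * t) \<le> f (b * t)" unfolding f_def using b t by (intro dim_fun_mono) simp
      with lower[OF t] show "f (b * t) \<ge> ereal (exp t) - ereal (2 + \<epsilon>)" by (rule order_trans)
      have "f t - ereal (2 + \<epsilon>) \<le> f t" using assms(2) by (cases "f t") auto
      with upper[OF t] show "ereal (exp (b * t)) \<ge> f t - ereal (2 + \<epsilon>)" by (rule order_trans[rotated])
    qed
    then show ?thesis
      unfolding exponential_dimension_growth_def dimension_growth_def f_def[symmetric]
      by (rule growth_eqI)
  qed
  ultimately show ?thesis by blast
qed

end
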